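(* Let $K$ be a field and let $A$ be a right Ore domain. If $A$ is a finitely generated $K$-algebra such that $\mathrm{GKdim}(A)<\mathrm{GKdim}(Z(A))+1$, then $$Z(Q_r(A))=\left\{\tfrac{p}{q}\;\middle|\; p,q\in Z(A),\ q\neq 0\right\}\cong Q(Z(A)).$$
   Context: Rings are associative with $1$, not necessarily commutative. A right Ore domain is a domain $A$ (nonzero, without zero divisors) such that $aA\cap bA\neq 0$ for all nonzero $a,b\in A$. $Q_r(A)$ denotes the right total ring of fractions of $A$, i.e. the division ring of right fractions $\frac{p}{q}=pq^{-1}$ with $p,q\in A$, $q\neq 0$, in which $A$ embeds by $a\mapsto \frac{a}{1}$. $Z(B)$ denotes the center of a ring $B$. $Q(Z(A))$ denotes the total ring of fractions (field of fractions) of the commutative domain $Z(A)$. $\mathrm{GKdim}$ denotes the Gelfand-Kirillov dimension over $K$: for a $K$-algebra $B$, $\mathrm{GKdim}(B)=\sup_V \limsup_{n\to\infty}\frac{\log \dim_K (V^n)}{\log n}$, where $V$ runs over the finite-dimensional $K$-subspaces of $B$ containing $1$, and $V^n$ is the $K$-span of all products of $n$ elements of $V$. The symbol $\cong$ denotes ring isomorphism. *)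

theory Defs
  imports
    "Jordan_Normal_Form.Missing_VectorSpace"
    "HOL-Algebra.QuotRing"
    "HOL-Algebra.Subrings"
    "HOL-Library.Extended_Real"
begin

text \<open>The locale \<open>domain\<close> of HOL-Algebra is commutative, so noncommutative domains are
  introduced here.\<close>

locale nc_domain = ring A for A (structure) +
  assumes one_neq_zero: "\<one> \<noteq> \<zero>"
    and no_zero_divisors:
      "\<lbrakk>a \<in> carrier A; b \<in> carrier A; a \<otimes> b = \<zero>\<rbrakk> \<Longrightarrow> a = \<zero> \<or> b = \<zero>"

locale right_ore_domain = nc_domain +
  assumes right_ore:
    "\<lbrakk>a \<in> carrier A; b \<in> carrier A; a \<noteq> \<zero>; b \<noteq> \<zero>\<rbrakk>
      \<Longrightarrow> (\<lambda>x. a \<otimes> x) ` carrier A \<inter> (\<lambda>x. b \<otimes> x) ` carrier A \<noteq> {\<zero>}"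

text \<open>The right fraction \<open>p / q\<close> is the class of all pairs \<open>(p', q')\<close> that agree with \<open>(p, q)\<close>
  after both are expanded, by factors on the right, to a common nonzero denominator.\<close>

definition right_frac :: "('a, 'm) ring_scheme \<Rightarrow> 'a \<Rightarrow> 'a \<Rightarrow> ('a \<times> 'a) set" where
  "right_frac A p q =
    {(p', q'). p' \<in> carrier A \<and> q' \<in> carrier A \<and> q' \<noteq> \<zero>\<^bsub>A\<^esub> \<and>
      (\<exists>c\<in>carrier A. \<exists>d\<in>carrier A.
        p \<otimes>\<^bsub>A\<^esub> c = p' \<otimes>\<^bsub>A\<^esub> d \<and> q \<otimes>\<^bsub>A\<^esub> c = q' \<otimes>\<^bsub>A\<^esub> d \<and> q \<otimes>\<^bsub>A\<^esub> c \<noteq> \<zero>\<^bsub>A\<^esub>)}"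

text \<open>Sums: \<open>p / q + p' / q' = (p c + p' d) / (q c)\<close> whenever \<open>q c = q' d \<noteq> 0\<close>.
  Products: \<open>(p / q) (p' / q') = (p c) / (q' d)\<close> whenever \<open>q c = p' d\<close> with \<open>d \<noteq> 0\<close>, that is,
  whenever \<open>q\<inverse> p' = c d\<inverse>\<close>.  Over a right Ore domain such \<open>c\<close> and \<open>d\<close> exist and the result does
  not depend on the choices, so the unions below are unions over one and the same class.\<close>

definition right_frac_add ::
    "('a, 'm) ring_scheme \<Rightarrow> ('a \<times> 'a) set \<Rightarrow> ('a \<times> 'a) set \<Rightarrow> ('a \<times> 'a) set" where
  "right_frac_add A X Y =
    \<Union> {right_frac A (p \<otimes>\<^bsub>A\<^esub> c \<oplus>\<^bsub>A\<^esub> p' \<otimes>\<^bsub>A\<^esub> d) (q \<otimes>\<^bsub>A\<^esub> c) | p q p' q' c d.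
      (p, q) \<in> X \<and> (p', q') \<in> Y \<and> c \<in> carrier A \<and> d \<in> carrier A \<and>
      q \<otimes>\<^bsub>A\<^esub> c = q' \<otimes>\<^bsub>A\<^esub> d \<and> q \<otimes>\<^bsub>A\<^esub> c \<noteq> \<zero>\<^bsub>A\<^esub>}"

definition right_frac_mult ::
    "('a, 'm) ring_scheme \<Rightarrow> ('a \<times> 'a) set \<Rightarrow> ('a \<times> 'a) set \<Rightarrow> ('a \<times> 'a) set" where
  "right_frac_mult A X Y =
    \<Union> {right_frac A (p \<otimes>\<^bsub>A\<^esub> c) (q' \<otimes>\<^bsub>A\<^esub> d) | p q p' q' c d.
      (p, q) \<in> X \<and> (p', q') \<in> Y \<and> c \<in> carrier A \<and> d \<in> carrier A \<and>
      q \<otimes>\<^bsub>A\<^esub> c = p' \<otimes>\<^bsub>A\<^esub> d \<and> d \<noteq> \<zero>\<^bsub>A\<^esub>}"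

text \<open>For a commutative domain this is the usual field of fractions: there
  \<open>p / q = p' / q'\<close> amounts to \<open>p q' = p' q\<close>, and the operations are the usual ones.\<close>

definition right_fractions :: "('a, 'm) ring_scheme \<Rightarrow> ('a \<times> 'a) set ring" where
  "right_fractions A =
    \<lparr>carrier = {right_frac A p q | p q. p \<in> carrier A \<and> q \<in> carrier A \<and> q \<noteq> \<zero>\<^bsub>A\<^esub>},
     mult = right_frac_mult A,
     one = right_frac A \<one>\<^bsub>A\<^esub> \<one>\<^bsub>A\<^esub>,
     zero = right_frac A \<zero>\<^bsub>A\<^esub> \<one>\<^bsub>A\<^esub>,
     add = right_frac_add A\<rparr>"


definition ring_center :: "('a, 'm) ring_scheme \<Rightarrow> 'a set" where
  "ring_center B = {z \<in> carrier B. \<forall>x\<in>carrier B. z \<otimes>\<^bsub>B\<^esub> x = x \<otimes>\<^bsub>B\<^esub> z}"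

text \<open>The center as a ring; if \<open>B\<close> is an algebra, its scalar multiplication is kept.\<close>

abbreviation center_ring :: "('a, 'm) ring_scheme \<Rightarrow> ('a, 'm) ring_scheme" where
  "center_ring B \<equiv> B\<lparr>carrier := ring_center B\<rparr>"


text \<open>The locale \<open>algebra\<close> of HOL-Algebra requires a commutative ring.\<close>

locale assoc_algebra = vectorspace K A + ring A for K and A (structure) +
  assumes smult_mult_left:
      "\<lbrakk>k \<in> carrier K; x \<in> carrier A; y \<in> carrier A\<rbrakk> \<Longrightarrow> (k \<odot> x) \<otimes> y = k \<odot> (x \<otimes> y)"
    and smult_mult_right:
      "\<lbrakk>k \<in> carrier K; x \<in> carrier A; y \<in> carrier A\<rbrakk> \<Longrightarrow> x \<otimes> (k \<odot> y) = k \<odot> (x \<otimes> y)"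

definition finitely_generated_algebra ::
    "('k, 'c) ring_scheme \<Rightarrow> ('k, 'a, 'm) module_scheme \<Rightarrow> bool" where
  "finitely_generated_algebra K A \<longleftrightarrow>
    (\<exists>S. finite S \<and> S \<subseteq> carrier A \<and>
      (\<forall>B. subring B A \<and> LinearCombinations.submodule K B A \<and> S \<subseteq> B \<longrightarrow> B = carrier A))"

definition subspace_power ::
    "('k, 'c) ring_scheme \<Rightarrow> ('k, 'a, 'm) module_scheme \<Rightarrow> 'a set \<Rightarrow> nat \<Rightarrow> 'a set" where
  "subspace_power K B V n =
    LinearCombinations.module.span K B {foldr (mult B) xs \<one>\<^bsub>B\<^esub> | xs. set xs \<subseteq> V \<and> length xs = n}"

definition GKdim :: "('k, 'c) ring_scheme \<Rightarrow> ('k, 'a, 'm) module_scheme \<Rightarrow> ereal" where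
  "GKdim K B =
    (SUP V \<in> {V. VectorSpace.subspace K V B \<and> vectorspace.fin_dim K (B\<lparr>carrier := V\<rparr>) \<and> \<one>\<^bsub>B\<^esub> \<in> V}.
      limsup (\<lambda>n. ereal
        (ln (real (vectorspace.dim K (B\<lparr>carrier := subspace_power K B V n\<rparr>))) / ln (real n))))"

end

theory Submission
  imports
    Defs
    "HOL-Analysis.Extended_Real_Limits"
    "HOL-Real_Asymp.Real_Asymp"
begin

text \<open>Every nonzero \<open>a \<in> A\<close> is a left divisor of a nonzero central element.  If not, then
  \<open>a A \<inter> Z(A) = 0\<close>.  Let \<open>W \<subseteq> Z(A)\<close> be a finite-dimensional subspace containing \<open>1\<close>, let \<open>\<beta>\<close> be a
  basis of \<open>W\<^sup>n\<close> and put \<open>U = W + K a\<close>.  Then \<open>\<beta> \<union> a T\<close> is linearly independent whenever \<open>T\<close> is, so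
  iterating \<open>T \<mapsto> \<beta> \<union> a T\<close> from the empty set \<open>n\<close> times gives \<open>n dim W\<^sup>n\<close> independent elements of
  \<open>U\<^bsup>2n\<^esup>\<close>.  Taking logarithms, \<open>GKdim A \<ge> GKdim Z(A) + 1\<close>, a contradiction.

  Consequently every right fraction can be written \<open>p / z\<close> with \<open>z\<close> central, and if it is central in
  \<open>Q\<^sub>r(A)\<close> then so is \<open>p = (p / z) z\<close>.  Intersecting a central fraction, a class of pairs, with
  \<open>Z(A) \<times> Z(A)\<close> gives the isomorphism onto \<open>Q(Z(A))\<close>.\<close>

subsection \<open>Right fractions\<close>

context nc_domain
begin

lemma nc_mult_left_cancel:
  assumes "a \<in> carrier A" "b \<in> carrier A" "c \<in> carrier A" "c \<noteq> \<zero>" "c \<otimes> a = c \<otimes> b"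
  shows "a = b"
proof -
  have "c \<otimes> (a \<ominus> b) = \<zero>"
    using assms by (simp add: a_minus_def r_distr r_minus r_neg)
  with assms no_zero_divisors[of c "a \<ominus> b"] show ?thesis
    by (metis a_minus_def add.inv_closed add.m_closed r_right_minus_eq)
qed

lemma nc_mult_right_cancel:
  assumes "a \<in> carrier A" "b \<in> carrier A" "c \<in> carrier A" "c \<noteq> \<zero>" "a \<otimes> c = b \<otimes> c"
  shows "a = b"
proof -
  have "(a \<ominus> b) \<otimes> c = \<zero>"
    using assms by (simp add: a_minus_def l_distr l_minus r_neg)
  with assms no_zero_divisors[of "a \<ominus> b" c] show ?thesis
    by (metis a_minus_def add.inv_closed add.m_closed r_right_minus_eq)
qed

lemma nc_mult_eq_zero_iff:
  assumes "a \<in> carrier A" "b \<in> carrier A"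
  shows "a \<otimes> b = \<zero> \<longleftrightarrow> a = \<zero> \<or> b = \<zero>"
  using assms no_zero_divisors by auto

end

section \<open>Equality, sums and products of right fractions\<close>

context right_ore_domain
begin

lemma common_right_multiple:
  assumes "a \<in> carrier A" "b \<in> carrier A" "a \<noteq> \<zero>" "b \<noteq> \<zero>"
  obtains c d where "c \<in> carrier A" "d \<in> carrier A" "a \<otimes> c = b \<otimes> d" "a \<otimes> c \<noteq> \<zero>"
proof -
  \<comment> \<open>\<open>right_ore\<close> says that the intersection differs from the set
    containing only zero, which the empty set would also satisfy. Since zero lies in the
    intersection, there must be a nonzero element.\<close>
  have "\<zero> \<in> (\<lambda>x. a \<otimes> x) ` carrier A \<inter> (\<lambda>x. b \<otimes> x) ` carrier A"
    using assms by (force simp: image_iff intro: bexI[of _ \<zero>])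
  with right_ore[OF assms] obtain z where
    "z \<in> (\<lambda>x. a \<otimes> x) ` carrier A \<inter> (\<lambda>x. b \<otimes> x) ` carrier A" "z \<noteq> \<zero>"
    by blast
  then show ?thesis using that by auto
qed

text \<open>Membership provides one pair of expansion factors \<open>c0\<close>, \<open>d0\<close>;
  the lemma passes to any other pair. Choose \<open>u\<close>, \<open>v\<close> with
  \<open>c u = c0 v\<close>. Cancelling \<open>q'\<close> on the left gives
  \<open>d u = d0 v\<close>, so the numerators agree after multiplication by \<open>u\<close>, which
  is cancelled on the right. All later comparisons of fractions rest on this.\<close>

lemma mem_right_frac_cancel:
  assumes mem: "(p', q') \<in> right_frac A p q"
    and car: "p \<in> carrier A" "q \<in> carrier A" "q \<noteq> \<zero>" "c \<in> carrier A" "d \<in> carrier A"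
    and eq: "q \<otimes> c = q' \<otimes> d"
  shows "p \<otimes> c = p' \<otimes> d"
proof -
  from mem obtain c0 d0 where p': "p' \<in> carrier A" "q' \<in> carrier A" "q' \<noteq> \<zero>"
    and cd0: "c0 \<in> carrier A" "d0 \<in> carrier A" "p \<otimes> c0 = p' \<otimes> d0" "q \<otimes> c0 = q' \<otimes> d0" "q \<otimes> c0 \<noteq> \<zero>"
    by (auto simp: right_frac_def)
  show ?thesis
  proof (cases "c = \<zero>")
    \<comment> \<open>A common right multiple exists only for nonzero factors, so
      \<open>c = 0\<close> is treated apart; it forces \<open>d = 0\<close>.\<close>
    case True
    with eq car p' have "d = \<zero>"
      using no_zero_divisors[of q' d] by auto
    with True car p' show ?thesis by simp
  next
    case False
    have "c0 \<noteq> \<zero>" using cd0(5) car r_null[of q] by metis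
    with False obtain u v where uv: "u \<in> carrier A" "v \<in> carrier A" "c \<otimes> u = c0 \<otimes> v" "c \<otimes> u \<noteq> \<zero>"
      using common_right_multiple[of c c0] car cd0 by metis
    then have u: "u \<noteq> \<zero>" using car by auto
    have "q' \<otimes> (d \<otimes> u) = q \<otimes> (c \<otimes> u)"
      using car uv(1,2) p' eq by (simp add: m_assoc[symmetric])
    also have "\<dots> = q' \<otimes> (d0 \<otimes> v)"
      using car uv p' cd0 by (simp add: m_assoc[symmetric])
    finally have du: "d \<otimes> u = d0 \<otimes> v"
      using nc_mult_left_cancel car uv p' cd0 by (meson m_closed)
    have "(p \<otimes> c) \<otimes> u = p \<otimes> (c0 \<otimes> v)"
      using car uv by (simp add: m_assoc)
    also have "\<dots> = p' \<otimes> (d0 \<otimes> v)"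
      using car uv p' cd0 by (simp add: m_assoc[symmetric])
    also have "\<dots> = (p' \<otimes> d) \<otimes> u"
      using car uv p' by (simp add: du[symmetric] m_assoc)
    finally show ?thesis
      using nc_mult_right_cancel car uv p' u by (meson m_closed)
  qed
qed

lemma mem_right_fracI:
  assumes "p' \<in> carrier A" "q' \<in> carrier A" "q' \<noteq> \<zero>" "c \<in> carrier A" "d \<in> carrier A"
    "p \<otimes> c = p' \<otimes> d" "q \<otimes> c = q' \<otimes> d" "q \<otimes> c \<noteq> \<zero>"
  shows "(p', q') \<in> right_frac A p q"
  using assms unfolding right_frac_def by blast

lemma mem_right_fracD:
  assumes "(p', q') \<in> right_frac A p q"
  shows "p' \<in> carrier A" "q' \<in> carrier A" "q' \<noteq> \<zero>"
  using assms by (auto simp: right_frac_def)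

lemma mem_right_frac_self:
  assumes "p \<in> carrier A" "q \<in> carrier A" "q \<noteq> \<zero>"
  shows "(p, q) \<in> right_frac A p q"
  using assms by (intro mem_right_fracI[of _ _ \<one> \<one>]) auto

lemma mem_right_frac_sym:
  assumes "(p', q') \<in> right_frac A p q" "p \<in> carrier A" "q \<in> carrier A" "q \<noteq> \<zero>"
  shows "(p, q) \<in> right_frac A p' q'"
proof -
  from assms obtain c d where "c \<in> carrier A" "d \<in> carrier A"
    "p \<otimes> c = p' \<otimes> d" "q \<otimes> c = q' \<otimes> d" "q \<otimes> c \<noteq> \<zero>"
    unfolding right_frac_def by blast
  then show ?thesis using assms by (intro mem_right_fracI[of _ _ d c]) auto
qed

text \<open>The outer denominators are expanded to a common multiple \<open>q c = q'' e\<close>, and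
  this is expanded once more by \<open>x\<close> until it is also a multiple of \<open>q'\<close>.
  Over that denominator all three numerators can be compared.\<close>

lemma mem_right_frac_trans:
  assumes "(p', q') \<in> right_frac A p q" "(p'', q'') \<in> right_frac A p' q'"
    and pq: "p \<in> carrier A" "q \<in> carrier A" "q \<noteq> \<zero>"
  shows "(p'', q'') \<in> right_frac A p q"
proof -
  note D = mem_right_fracD[OF assms(1)] mem_right_fracD[OF assms(2)]
  obtain c e where ce: "c \<in> carrier A" "e \<in> carrier A" "q \<otimes> c = q'' \<otimes> e" "q \<otimes> c \<noteq> \<zero>"
    using common_right_multiple pq D by metis
  have c: "q \<otimes> c \<in> carrier A" using pq(2) ce(1) by (rule m_closed)
  obtain x y where xy: "x \<in> carrier A" "y \<in> carrier A" "(q \<otimes> c) \<otimes> x = q' \<otimes> y" "(q \<otimes> c) \<otimes> x \<noteq> \<zero>"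
    using common_right_multiple[OF c D(2) ce(4) D(3)] by metis
  have "p \<otimes> (c \<otimes> x) = p' \<otimes> y"
    using xy ce(1,2) pq by (intro mem_right_frac_cancel[OF assms(1)]) (auto simp: m_assoc)
  also have "\<dots> = p'' \<otimes> (e \<otimes> x)"
    using xy ce pq D by (intro mem_right_frac_cancel[OF assms(2)]) (auto simp: m_assoc[symmetric])
  finally show ?thesis
    using xy ce pq D
    by (intro mem_right_fracI[of _ _ "c \<otimes> x" "e \<otimes> x"]) (auto simp: m_assoc[symmetric])
qed

lemma right_frac_eq:
  assumes mem: "(p', q') \<in> right_frac A p q" and pq: "p \<in> carrier A" "q \<in> carrier A" "q \<noteq> \<zero>"
  shows "right_frac A p' q' = right_frac A p q"
proof -
  note D = mem_right_fracD[OF mem]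
  show ?thesis
    using mem_right_frac_trans[OF mem _ pq]
      mem_right_frac_trans[OF mem_right_frac_sym[OF mem pq] _ D] by auto
qed

text \<open>With equal denominators no expansion is required: the cancellation lemma applies with
  both factors equal to one.\<close>

lemma right_frac_eqD:
  assumes "right_frac A p' q = right_frac A p q" "p' \<in> carrier A" "p \<in> carrier A"
    "q \<in> carrier A" "q \<noteq> \<zero>"
  shows "p' = p"
proof -
  have "(p', q) \<in> right_frac A p q"
    using mem_right_frac_self[of p' q] assms by metis
  from mem_right_frac_cancel[OF this assms(3-5) one_closed one_closed refl] assms(2,3)
  show ?thesis by simp
qed

lemma right_frac_expand:
  assumes "p \<in> carrier A" "q \<in> carrier A" "q \<noteq> \<zero>" "b \<in> carrier A" "b \<noteq> \<zero>"
  shows "right_frac A (p \<otimes> b) (q \<otimes> b) = right_frac A p q"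
  using assms
  by (intro right_frac_eq mem_right_fracI[of _ _ b \<one>]) (auto simp: nc_mult_eq_zero_iff)

text \<open>The product is defined as a union over all representatives and all admissible
  \<open>c\<close>, \<open>d\<close>; here every member of that union is shown to be the same class,
  so one convenient choice computes the product.\<close>

lemma right_frac_mult_eq:
  assumes car: "p \<in> carrier A" "q \<in> carrier A" "q \<noteq> \<zero>" "p' \<in> carrier A" "q' \<in> carrier A" "q' \<noteq> \<zero>"
    "c \<in> carrier A" "d \<in> carrier A" "d \<noteq> \<zero>" and eq: "q \<otimes> c = p' \<otimes> d"
  shows "right_frac_mult A (right_frac A p q) (right_frac A p' q') = right_frac A (p \<otimes> c) (q' \<otimes> d)"
proof -
  have wd: "right_frac A (p1 \<otimes> c1) (q1' \<otimes> d1) = right_frac A (p \<otimes> c) (q' \<otimes> d)"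
    if m: "(p1, q1) \<in> right_frac A p q" "(p1', q1') \<in> right_frac A p' q'"
      and c1: "c1 \<in> carrier A" "d1 \<in> carrier A" "q1 \<otimes> c1 = p1' \<otimes> d1" "d1 \<noteq> \<zero>"
    for p1 q1 p1' q1' c1 d1
  proof -
    note D = mem_right_fracD[OF m(1)] mem_right_fracD[OF m(2)]
    have nz: "q' \<otimes> d \<noteq> \<zero>" "q1' \<otimes> d1 \<noteq> \<zero>"
      using car c1 D by (auto simp: nc_mult_eq_zero_iff)
    \<comment> \<open>Two choices are compared by equalizing the final denominators. Cancellation in
      the second class turns this into equality of \<open>p' d u\<close> and
      \<open>p1' d1 v\<close>, which are \<open>q c u\<close> and \<open>q1 c1 v\<close>;
      cancellation in the first class then equalizes the numerators.\<close>
    obtain u v where uv: "u \<in> carrier A" "v \<in> carrier A"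
      "(q' \<otimes> d) \<otimes> u = (q1' \<otimes> d1) \<otimes> v" "(q' \<otimes> d) \<otimes> u \<noteq> \<zero>"
      using common_right_multiple[OF _ _ nz] car c1 D m_closed by metis
    have "p' \<otimes> (d \<otimes> u) = p1' \<otimes> (d1 \<otimes> v)"
      using car c1 D uv by (intro mem_right_frac_cancel[OF m(2)]) (auto simp: m_assoc)
    then have "q \<otimes> (c \<otimes> u) = q1 \<otimes> (c1 \<otimes> v)"
      using car c1 D uv eq by (simp add: m_assoc[symmetric])
    then have "p \<otimes> (c \<otimes> u) = p1 \<otimes> (c1 \<otimes> v)"
      using car c1 D uv by (intro mem_right_frac_cancel[OF m(1)]) auto
    then show ?thesis
      using car c1 D uv nz
      by (intro right_frac_eq mem_right_fracI[of _ _ u v]) (auto simp: m_assoc)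
  qed
  have self: "(p, q) \<in> right_frac A p q" "(p', q') \<in> right_frac A p' q'"
    using car by (auto intro: mem_right_frac_self)
  \<comment> \<open>The given choice itself occurs in the family, so the family is a singleton
    rather than empty and its union is the class sought.\<close>
  have "{right_frac A (p1 \<otimes> c1) (q1' \<otimes> d1) | p1 q1 p1' q1' c1 d1.
      (p1, q1) \<in> right_frac A p q \<and> (p1', q1') \<in> right_frac A p' q' \<and> c1 \<in> carrier A \<and>
      d1 \<in> carrier A \<and> q1 \<otimes> c1 = p1' \<otimes> d1 \<and> d1 \<noteq> \<zero>} = {right_frac A (p \<otimes> c) (q' \<otimes> d)}"
    (is "?L = _")
  proof
    show "?L \<subseteq> {right_frac A (p \<otimes> c) (q' \<otimes> d)}" using wd by blast
    show "{right_frac A (p \<otimes> c) (q' \<otimes> d)} \<subseteq> ?L" using self car eq by blast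
  qed
  then show ?thesis by (simp add: right_frac_mult_def)
qed

text \<open>Independence of choices is again the point. Once the two denominators are expanded to
  agree, they are at the same time denominators for both summands, so cancellation applies to each
  summand separately.\<close>

lemma right_frac_add_eq:
  assumes car: "p \<in> carrier A" "q \<in> carrier A" "q \<noteq> \<zero>" "p' \<in> carrier A" "q' \<in> carrier A" "q' \<noteq> \<zero>"
    "c \<in> carrier A" "d \<in> carrier A" "q \<otimes> c \<noteq> \<zero>" and eq: "q \<otimes> c = q' \<otimes> d"
  shows "right_frac_add A (right_frac A p q) (right_frac A p' q') =
    right_frac A (p \<otimes> c \<oplus> p' \<otimes> d) (q \<otimes> c)"
proof -
  have wd: "right_frac A (p1 \<otimes> c1 \<oplus> p1' \<otimes> d1) (q1 \<otimes> c1) = right_frac A (p \<otimes> c \<oplus> p' \<otimes> d) (q \<otimes> c)"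
    if m: "(p1, q1) \<in> right_frac A p q" "(p1', q1') \<in> right_frac A p' q'"
      and c1: "c1 \<in> carrier A" "d1 \<in> carrier A" "q1 \<otimes> c1 = q1' \<otimes> d1" "q1 \<otimes> c1 \<noteq> \<zero>"
    for p1 q1 p1' q1' c1 d1
  proof -
    note D = mem_right_fracD[OF m(1)] mem_right_fracD[OF m(2)]
    obtain u v where uv: "u \<in> carrier A" "v \<in> carrier A"
      "(q \<otimes> c) \<otimes> u = (q1 \<otimes> c1) \<otimes> v" "(q \<otimes> c) \<otimes> u \<noteq> \<zero>"
      using common_right_multiple[OF _ _ car(9) c1(4)] car c1 D m_closed by metis
    have 1: "p \<otimes> (c \<otimes> u) = p1 \<otimes> (c1 \<otimes> v)"
      using car c1(1,2) D uv by (intro mem_right_frac_cancel[OF m(1)]) (auto simp: m_assoc)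
    have "q' \<otimes> (d \<otimes> u) = q1' \<otimes> (d1 \<otimes> v)"
      using car c1 D uv eq by (simp add: m_assoc[symmetric])
    then have 2: "p' \<otimes> (d \<otimes> u) = p1' \<otimes> (d1 \<otimes> v)"
      using car c1 D uv by (intro mem_right_frac_cancel[OF m(2)]) auto
    have "(p \<otimes> c \<oplus> p' \<otimes> d) \<otimes> u = (p1 \<otimes> c1 \<oplus> p1' \<otimes> d1) \<otimes> v"
      using 1 2 car c1 D uv by (simp add: l_distr m_assoc)
    then show ?thesis
      using car c1 D uv by (intro right_frac_eq mem_right_fracI[of _ _ u v]) auto
  qed
  have self: "(p, q) \<in> right_frac A p q" "(p', q') \<in> right_frac A p' q'"
    using car by (auto intro: mem_right_frac_self)
  have "{right_frac A (p1 \<otimes> c1 \<oplus> p1' \<otimes> d1) (q1 \<otimes> c1) | p1 q1 p1' q1' c1 d1.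
      (p1, q1) \<in> right_frac A p q \<and> (p1', q1') \<in> right_frac A p' q' \<and> c1 \<in> carrier A \<and>
      d1 \<in> carrier A \<and> q1 \<otimes> c1 = q1' \<otimes> d1 \<and> q1 \<otimes> c1 \<noteq> \<zero>} =
      {right_frac A (p \<otimes> c \<oplus> p' \<otimes> d) (q \<otimes> c)}" (is "?L = _")
  proof
    show "?L \<subseteq> {right_frac A (p \<otimes> c \<oplus> p' \<otimes> d) (q \<otimes> c)}" using wd by blast
    show "{right_frac A (p \<otimes> c \<oplus> p' \<otimes> d) (q \<otimes> c)} \<subseteq> ?L" using self car eq by blast
  qed
  then show ?thesis by (simp add: right_frac_add_def)
qed

end

section \<open>The center as a subring\<close>

context ring
begin

lemma ring_center_closed:
  assumes "z \<in> ring_center R" shows "z \<in> carrier R"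
  using assms by (simp add: ring_center_def)

lemma ring_center_commute:
  assumes "z \<in> ring_center R" "x \<in> carrier R" shows "z \<otimes> x = x \<otimes> z"
  using assms by (simp add: ring_center_def)

lemma ring_centerI:
  assumes "z \<in> carrier R" "\<And>x. x \<in> carrier R \<Longrightarrow> z \<otimes> x = x \<otimes> z"
  shows "z \<in> ring_center R"
  using assms by (simp add: ring_center_def)

lemma subring_ring_center: "subring (ring_center R) R"
proof (rule subringI)
  show "ring_center R \<subseteq> carrier R" using ring_center_closed by blast
  show "\<one> \<in> ring_center R" by (rule ring_centerI) auto
  fix x y assume xy: "x \<in> ring_center R" "y \<in> ring_center R"
  note car = xy[THEN ring_center_closed]
  show "\<ominus> x \<in> ring_center R"
    by (intro ring_centerI) (simp_all add: car l_minus r_minus ring_center_commute[OF xy(1)])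
  show "x \<oplus> y \<in> ring_center R"
    by (intro ring_centerI)
      (simp_all add: car l_distr r_distr ring_center_commute[OF xy(1)] ring_center_commute[OF xy(2)])
  show "x \<otimes> y \<in> ring_center R"
  proof (rule ring_centerI)
    fix w assume w: "w \<in> carrier R"
    have "(x \<otimes> y) \<otimes> w = x \<otimes> (w \<otimes> y)"
      using car w ring_center_commute[OF xy(2) w] by (simp add: m_assoc)
    also have "\<dots> = (w \<otimes> x) \<otimes> y"
      using car w by (simp add: m_assoc[symmetric] ring_center_commute[OF xy(1) w])
    finally show "(x \<otimes> y) \<otimes> w = w \<otimes> (x \<otimes> y)" using car w by (simp add: m_assoc)
  qed (use car in simp)
qed

lemma ring_center_ring: "ring (center_ring R)"
  using subring_is_ring[OF subring_ring_center] .

end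

context nc_domain
begin

text \<open>The Ore condition holds because \<open>a b = b a\<close> is a nonzero common multiple.
  This makes all results on right fractions available for the center as well, where they describe
  its field of fractions.\<close>

lemma right_ore_domain_center_ring: "right_ore_domain (center_ring A)"
proof -
  interpret Z: ring "center_ring A" by (rule ring_center_ring)
  note cl = ring_center_closed
  show ?thesis
  proof
    show "\<one>\<^bsub>center_ring A\<^esub> \<noteq> \<zero>\<^bsub>center_ring A\<^esub>" using one_neq_zero by simp
  next
    fix a b assume "a \<in> carrier (center_ring A)" "b \<in> carrier (center_ring A)"
      "a \<otimes>\<^bsub>center_ring A\<^esub> b = \<zero>\<^bsub>center_ring A\<^esub>"
    then show "a = \<zero>\<^bsub>center_ring A\<^esub> \<or> b = \<zero>\<^bsub>center_ring A\<^esub>"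
      using no_zero_divisors cl by simp
  next
    fix a b assume ab: "a \<in> carrier (center_ring A)" "b \<in> carrier (center_ring A)"
      "a \<noteq> \<zero>\<^bsub>center_ring A\<^esub>" "b \<noteq> \<zero>\<^bsub>center_ring A\<^esub>"
    then have "a \<otimes> b \<noteq> \<zero>" "a \<otimes> b = b \<otimes> a"
      using no_zero_divisors[of a b] cl ring_center_commute by auto
    moreover have "a \<otimes> b \<in> (\<otimes>) a ` ring_center A" "b \<otimes> a \<in> (\<otimes>) b ` ring_center A"
      using ab by auto
    ultimately show "(\<lambda>x. a \<otimes>\<^bsub>center_ring A\<^esub> x) ` carrier (center_ring A) \<inter>
        (\<lambda>x. b \<otimes>\<^bsub>center_ring A\<^esub> x) ` carrier (center_ring A) \<noteq> {\<zero>\<^bsub>center_ring A\<^esub>}"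
      by auto
  qed
qed

end

section \<open>Fractions of central elements and the center of the ring of fractions\<close>

context right_ore_domain
begin

text \<open>Equality of fractions in \<open>A\<close> allows arbitrary expansion factors, equality
  in the center only central ones. For central pairs the denominators themselves serve: since
  \<open>q q' = q' q\<close>, cancellation gives \<open>p q' = p' q\<close>, and \<open>q'\<close>,
  \<open>q\<close> are central factors.\<close>

lemma right_frac_inter_center:
  assumes "p \<in> ring_center A" "q \<in> ring_center A" "q \<noteq> \<zero>"
  shows "right_frac A p q \<inter> (ring_center A \<times> ring_center A) = right_frac (center_ring A) p q"
proof -
  interpret Z: right_ore_domain "center_ring A" by (rule right_ore_domain_center_ring)
  note cl = ring_center_closed
  have "(p', q') \<in> right_frac (center_ring A) p q"
    if m: "(p', q') \<in> right_frac A p q" and z: "p' \<in> ring_center A" "q' \<in> ring_center A" for p' q'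
  proof -
    have "q \<otimes> q' = q' \<otimes> q" using ring_center_commute assms z cl by auto
    then have "p \<otimes> q' = p' \<otimes> q"
      using mem_right_frac_cancel[OF m, of q' q] assms z cl by auto
    with mem_right_fracD[OF m] assms z cl \<open>q \<otimes> q' = q' \<otimes> q\<close> show ?thesis
      by (intro Z.mem_right_fracI[of _ _ q' q]) (auto simp: nc_mult_eq_zero_iff)
  qed
  moreover have "right_frac (center_ring A) p q \<subseteq> right_frac A p q \<inter> (ring_center A \<times> ring_center A)"
    using cl by (fastforce simp: right_frac_def)
  ultimately show ?thesis by auto
qed

lemma right_frac_mult_center:
  assumes "p \<in> ring_center A" "q \<in> ring_center A" "q \<noteq> \<zero>"
    and "p' \<in> ring_center A" "q' \<in> ring_center A" "q' \<noteq> \<zero>"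
  shows "right_frac_mult A (right_frac A p q) (right_frac A p' q') = right_frac A (p \<otimes> p') (q' \<otimes> q)"
  using assms ring_center_closed ring_center_commute[of q p']
  by (intro right_frac_mult_eq) auto

lemma right_frac_add_center:
  assumes "p \<in> ring_center A" "q \<in> ring_center A" "q \<noteq> \<zero>"
    and "p' \<in> ring_center A" "q' \<in> ring_center A" "q' \<noteq> \<zero>"
  shows "right_frac_add A (right_frac A p q) (right_frac A p' q') =
    right_frac A (p \<otimes> q' \<oplus> p' \<otimes> q) (q \<otimes> q')"
  using assms ring_center_closed ring_center_commute[of q q']
  by (intro right_frac_add_eq) (auto simp: nc_mult_eq_zero_iff)

text \<open>Given that central fractions have central representatives, sums and products in both
  rings are computed by the same explicit formulas, which restriction to central pairs
  respects.\<close>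

lemma central_fractions_iso:
  assumes center: "ring_center (right_fractions A) =
    {right_frac A p q | p q. p \<in> ring_center A \<and> q \<in> ring_center A \<and> q \<noteq> \<zero>}"
  shows "center_ring (right_fractions A) \<simeq> right_fractions (center_ring A)"
proof -
  interpret Z: right_ore_domain "center_ring A" by (rule right_ore_domain_center_ring)
  \<comment> \<open>The center is its own center, so the formulas for central fractions can be used
    inside \<open>center_ring A\<close> too.\<close>
  have ZZ: "ring_center (center_ring A) = ring_center A"
    by (auto simp: ring_center_def)
  let ?h = "\<lambda>X. X \<inter> (ring_center A \<times> ring_center A)"
  note subr = subringE[OF subring_ring_center]
  note cl = ring_center_closed
  have fracE: "\<exists>p q. X = right_frac A p q \<and> p \<in> ring_center A \<and> q \<in> ring_center A \<and> q \<noteq> \<zero>"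
    if "X \<in> carrier (center_ring (right_fractions A))" for X
    using that center by auto
  have mem: "?h X \<in> carrier (right_fractions (center_ring A))"
    if "X \<in> carrier (center_ring (right_fractions A))" for X
    using fracE[OF that]
    by (simp add: right_fractions_def) (metis right_frac_inter_center)
  have "?h \<in> ring_iso (center_ring (right_fractions A)) (right_fractions (center_ring A))"
  proof (rule ring_iso_memI)
    show "?h X \<in> carrier (right_fractions (center_ring A))"
      if "X \<in> carrier (center_ring (right_fractions A))" for X
      using that by (rule mem)
  next
    fix X Y assume "X \<in> carrier (center_ring (right_fractions A))"
      "Y \<in> carrier (center_ring (right_fractions A))"
    with fracE obtain p q p' q' where
      X: "X = right_frac A p q" "p \<in> ring_center A" "q \<in> ring_center A" "q \<noteq> \<zero>" and
      Y: "Y = right_frac A p' q'" "p' \<in> ring_center A" "q' \<in> ring_center A" "q' \<noteq> \<zero>"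
      by metis
    have nz: "q' \<otimes> q \<noteq> \<zero>" "q \<otimes> q' \<noteq> \<zero>"
      using X Y cl by (auto simp: nc_mult_eq_zero_iff)
    show "?h (X \<otimes>\<^bsub>center_ring (right_fractions A)\<^esub> Y) =
        ?h X \<otimes>\<^bsub>right_fractions (center_ring A)\<^esub> ?h Y"
      using X Y nz subr Z.right_frac_mult_center[of p q p' q']
      by (simp add: right_fractions_def right_frac_mult_center right_frac_inter_center ZZ)
    show "?h (X \<oplus>\<^bsub>center_ring (right_fractions A)\<^esub> Y) =
        ?h X \<oplus>\<^bsub>right_fractions (center_ring A)\<^esub> ?h Y"
      using X Y nz subr Z.right_frac_add_center[of p q p' q']
      by (simp add: right_fractions_def right_frac_add_center right_frac_inter_center ZZ)
  next
    show "?h \<one>\<^bsub>center_ring (right_fractions A)\<^esub> = \<one>\<^bsub>right_fractions (center_ring A)\<^esub>"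
      using subr one_neq_zero by (simp add: right_fractions_def right_frac_inter_center)
  next
    have "inj_on ?h (carrier (center_ring (right_fractions A)))"
    proof (rule inj_onI)
      fix X Y assume "X \<in> carrier (center_ring (right_fractions A))"
        "Y \<in> carrier (center_ring (right_fractions A))" and eq: "?h X = ?h Y"
      with fracE obtain p q p' q' where
        X: "X = right_frac A p q" "p \<in> ring_center A" "q \<in> ring_center A" "q \<noteq> \<zero>" and
        Y: "Y = right_frac A p' q'" "p' \<in> ring_center A" "q' \<in> ring_center A" "q' \<noteq> \<zero>"
        by metis
      \<comment> \<open>The central pair representing \<open>X\<close> survives the restriction and
        therefore also lies in \<open>Y\<close>; classes with a common pair coincide.\<close>
      have "(p, q) \<in> ?h X" using X cl by (auto intro: mem_right_frac_self)
      with eq Y have "(p, q) \<in> right_frac A p' q'" by auto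
      with Y cl X show "X = Y" using right_frac_eq by auto
    qed
    moreover have "?h ` carrier (center_ring (right_fractions A)) = carrier (right_fractions (center_ring A))"
    proof (intro equalityI subsetI)
      fix Y assume "Y \<in> carrier (right_fractions (center_ring A))"
      then obtain p q where "p \<in> ring_center A" "q \<in> ring_center A" "q \<noteq> \<zero>"
        "Y = right_frac (center_ring A) p q"
        by (auto simp: right_fractions_def)
      then show "Y \<in> ?h ` carrier (center_ring (right_fractions A))"
        by (intro image_eqI[of _ _ "right_frac A p q"]) (auto simp: center right_frac_inter_center)
    qed (use mem in auto)
    ultimately show "bij_betw ?h (carrier (center_ring (right_fractions A)))
        (carrier (right_fractions (center_ring A)))"
      by (simp add: bij_betw_def)
  qed
  then show ?thesis by (auto simp: is_ring_iso_def)
qed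

lemma ring_center_right_fractions:
  assumes alg: "\<And>a. \<lbrakk>a \<in> carrier A; a \<noteq> \<zero>\<rbrakk> \<Longrightarrow>
    \<exists>b\<in>carrier A. a \<otimes> b \<in> ring_center A \<and> a \<otimes> b \<noteq> \<zero>"
  shows "ring_center (right_fractions A) =
    {right_frac A p q | p q. p \<in> ring_center A \<and> q \<in> ring_center A \<and> q \<noteq> \<zero>}"
proof (intro equalityI subsetI)
  note cl = ring_center_closed
  fix X assume X: "X \<in> ring_center (right_fractions A)"
  then obtain p q where pq: "X = right_frac A p q" "p \<in> carrier A" "q \<in> carrier A" "q \<noteq> \<zero>"
    by (auto simp: ring_center_def right_fractions_def)
  obtain b where b: "b \<in> carrier A" "q \<otimes> b \<in> ring_center A" "q \<otimes> b \<noteq> \<zero>"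
    using alg pq by blast
  have b0: "b \<noteq> \<zero>" using b pq by auto
  \<comment> \<open>Expanding by \<open>b\<close> makes the denominator central without changing the
    fraction.\<close>
  define s z where "s = p \<otimes> b" and "z = q \<otimes> b"
  have s: "s \<in> carrier A" and z: "z \<in> ring_center A" "z \<in> carrier A" "z \<noteq> \<zero>"
    using b pq cl by (auto simp: s_def z_def)
  have Xs: "X = right_frac A s z"
    using right_frac_expand pq b b0 by (simp add: s_def z_def)
  \<comment> \<open>It suffices to test \<open>X\<close> against the fractions \<open>x / 1\<close>.
    As \<open>z\<close> is central, both products have denominator \<open>z\<close>, so their
    numerators can be compared.\<close>
  have "s \<otimes> x = x \<otimes> s" if x: "x \<in> carrier A" for x
  proof -
    have "right_frac A x \<one> \<in> carrier (right_fractions A)"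
      using x one_neq_zero by (auto simp: right_fractions_def)
    with X have "right_frac_mult A X (right_frac A x \<one>) = right_frac_mult A (right_frac A x \<one>) X"
      by (simp add: ring_center_def right_fractions_def)
    moreover have "right_frac_mult A X (right_frac A x \<one>) = right_frac A (s \<otimes> x) (\<one> \<otimes> z)"
      unfolding Xs using s z x one_neq_zero ring_center_commute[of z x]
      by (intro right_frac_mult_eq) auto
    moreover have "right_frac_mult A (right_frac A x \<one>) X = right_frac A (x \<otimes> s) (z \<otimes> \<one>)"
      unfolding Xs using s z x one_neq_zero
      by (intro right_frac_mult_eq) auto
    ultimately have "right_frac A (s \<otimes> x) z = right_frac A (x \<otimes> s) z" using z by simp
    then show ?thesis using right_frac_eqD s z x by simp
  qed
  then have "s \<in> ring_center A" using s by (simp add: ring_center_def)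
  with Xs z show "X \<in> {right_frac A p q | p q. p \<in> ring_center A \<and> q \<in> ring_center A \<and> q \<noteq> \<zero>}"
    by blast
next
  note cl = ring_center_closed
  fix X assume "X \<in> {right_frac A p q | p q. p \<in> ring_center A \<and> q \<in> ring_center A \<and> q \<noteq> \<zero>}"
  then obtain p q where X: "X = right_frac A p q" and pq: "p \<in> ring_center A" "q \<in> ring_center A" "q \<noteq> \<zero>"
    by blast
  have "right_frac_mult A X Y = right_frac_mult A Y X" if Y: "Y \<in> carrier (right_fractions A)" for Y
  proof -
    from Y obtain x y where xy: "Y = right_frac A x y" "x \<in> carrier A" "y \<in> carrier A" "y \<noteq> \<zero>"
      by (auto simp: right_fractions_def)
    \<comment> \<open>The equations \<open>q x = x q\<close> and, below, \<open>y p = p y\<close>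
      supply the factors required by the product formula.\<close>
    have "right_frac_mult A X Y = right_frac A (p \<otimes> x) (y \<otimes> q)"
      unfolding X xy using xy pq cl ring_center_commute[of q x] by (intro right_frac_mult_eq) auto
    moreover have "right_frac_mult A Y X = right_frac A (x \<otimes> p) (q \<otimes> y)"
      unfolding X xy using xy pq cl ring_center_commute[of p y] by (intro right_frac_mult_eq) auto
    ultimately show ?thesis using xy pq ring_center_commute by metis
  qed
  moreover have "X \<in> carrier (right_fractions A)"
    using X pq cl by (auto simp: right_fractions_def)
  ultimately show "X \<in> ring_center (right_fractions A)"
    by (simp add: ring_center_def right_fractions_def)
qed

end

subsection \<open>Growth over the center\<close>

context vectorspace
begin

text \<open>Dimensions refer to the space with restricted carrier, whereas independence and span are
  wanted in the ambient space. This lemma and the next translate between the two.\<close>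

lemma subspace_basis_exists:
  assumes "VectorSpace.subspace K U V" "vectorspace.fin_dim K (V\<lparr>carrier := U\<rparr>)"
  obtains \<beta> where "finite \<beta>" "\<beta> \<subseteq> U" "lin_indpt \<beta>" "span \<beta> = U"
    "card \<beta> = vectorspace.dim K (V\<lparr>carrier := U\<rparr>)"
proof -
  interpret U: vectorspace K "V\<lparr>carrier := U\<rparr>" using subspace_is_vs[OF assms(1)] .
  note sub = is_module[OF assms(1)]
  from U.finite_basis_exists[OF assms(2)] obtain \<beta> where \<beta>: "finite \<beta>" "U.basis \<beta>"
    by blast
  then have "\<beta> \<subseteq> U" by (simp add: U.basis_def)
  with \<beta> show ?thesis
    using span_li_not_depend[OF _ sub, of \<beta>] U.dim_basis[of \<beta>]
    by (intro that[of \<beta>]) (auto simp: U.basis_def)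
qed

lemma lin_indpt_subset_card_le:
  assumes "VectorSpace.subspace K U V" "vectorspace.fin_dim K (V\<lparr>carrier := U\<rparr>)"
    and "T \<subseteq> U" "lin_indpt T"
  shows "finite T" "card T \<le> vectorspace.dim K (V\<lparr>carrier := U\<rparr>)"
proof -
  interpret U: vectorspace K "V\<lparr>carrier := U\<rparr>" using subspace_is_vs[OF assms(1)] .
  have "U.lin_indpt T"
    using span_li_not_depend[OF assms(3) is_module[OF assms(1)]] assms(4) by simp
  then show "finite T" "card T \<le> vectorspace.dim K (V\<lparr>carrier := U\<rparr>)"
    using U.li_le_dim[OF assms(2)] assms(3) by auto
qed

lemma fin_dim_span:
  assumes "finite X" "X \<subseteq> carrier V"
  shows "vectorspace.fin_dim K (V\<lparr>carrier := span X\<rparr>)"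
proof -
  interpret S: vectorspace K "V\<lparr>carrier := span X\<rparr>"
    using subspace_is_vs[OF span_is_subspace[OF assms(2)]] .
  have "X \<subseteq> span X" using in_own_span assms by blast
  then show ?thesis
    unfolding S.fin_dim_def
    using span_li_not_depend(1)[of X "span X"] span_is_submodule[OF assms(2)] assms
    by (intro exI[of _ X]) auto
qed

text \<open>In a vanishing combination the part over \<open>X\<close> is the negative of the part
  over \<open>Y\<close>, so it lies in both spans and is zero; then both parts have zero
  coefficients. An element common to \<open>X\<close> and \<open>Y\<close> would likewise be zero,
  which no independent set contains.\<close>

lemma lin_indpt_Un:
  assumes fin: "finite X" "finite Y" and car: "X \<subseteq> carrier V" "Y \<subseteq> carrier V"
    and li: "lin_indpt X" "lin_indpt Y" and span: "span X \<inter> span Y \<subseteq> {\<zero>\<^bsub>V\<^esub>}"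
  shows "X \<inter> Y = {}" "lin_indpt (X \<union> Y)"
proof -
  show disj: "X \<inter> Y = {}"
    using in_own_span[OF car(1)] in_own_span[OF car(2)] span vs_zero_lin_dep[OF car(1) li(1)]
    by blast
  show "lin_indpt (X \<union> Y)"
  proof (rule finite_lin_indpt2)
    fix c assume c: "c \<in> X \<union> Y \<rightarrow> carrier K" and "lincomb c (X \<union> Y) = \<zero>\<^bsub>V\<^esub>"
    then have cX: "c \<in> X \<rightarrow> carrier K" and cY: "c \<in> Y \<rightarrow> carrier K" by auto
    let ?x = "lincomb c X" and ?y = "lincomb c Y"
    have xy: "?x \<oplus>\<^bsub>V\<^esub> ?y = \<zero>\<^bsub>V\<^esub>"
      using lincomb_union[of X Y c] fin car disj c \<open>lincomb c (X \<union> Y) = \<zero>\<^bsub>V\<^esub>\<close> by auto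
    have x: "?x \<in> span X" and y: "?y \<in> span Y"
      using finite_span fin car cX cY by auto
    have xV: "?x \<in> carrier V" and yV: "?y \<in> carrier V"
      using car cX cY by auto
    then have "?x = \<ominus>\<^bsub>V\<^esub> ?y" using xy M.minus_equality by simp
    then have "?x \<in> span Y" using span_neg[OF car(2) y] by simp
    then have x0: "?x = \<zero>\<^bsub>V\<^esub>" using x span by auto
    then have y0: "?y = \<zero>\<^bsub>V\<^esub>" using xy yV by simp
    show "\<forall>v\<in>X \<union> Y. c v = \<zero>\<^bsub>K\<^esub>"
      using lin_dep_crit[OF fin(1) subset_refl cX _ _ x0] lin_dep_crit[OF fin(2) subset_refl cY _ _ y0] li
      by blast
  qed (use fin car in auto)
qed

end

text \<open>The generating set of \<open>subspace_power\<close> gets its own name because it is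
  finite for finite \<open>X\<close>, so powers can be spanned by finitely many words in a basis.
  Words have length exactly \<open>n\<close>, hence the powers increase only when the unit belongs
  to the subspace.\<close>

definition words :: "('a, 'm) monoid_scheme \<Rightarrow> 'a set \<Rightarrow> nat \<Rightarrow> 'a set" where
  "words M X n = {foldr (mult M) xs \<one>\<^bsub>M\<^esub> | xs. set xs \<subseteq> X \<and> length xs = n}"

lemma finite_words:
  assumes "finite X" shows "finite (words M X n)"
proof -
  from assms have "finite {xs. set xs \<subseteq> X \<and> length xs = n}" by (rule finite_lists_length_eq)
  then show ?thesis by (simp add: words_def setcompr_eq_image)
qed

lemma (in monoid) words_closed:
  assumes X: "X \<subseteq> carrier G" shows "words G X n \<subseteq> carrier G"
proof -
  have "set xs \<subseteq> X \<Longrightarrow> foldr (\<otimes>) xs \<one> \<in> carrier G" for xs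
    using X by (induction xs) auto
  then show ?thesis by (auto simp: words_def)
qed

lemma words_Suc: "words M X (Suc n) = {x \<otimes>\<^bsub>M\<^esub> w | x w. x \<in> X \<and> w \<in> words M X n}"
proof (intro equalityI subsetI)
  fix y assume "y \<in> words M X (Suc n)"
  then obtain xs where xs: "y = foldr (mult M) xs \<one>\<^bsub>M\<^esub>" "set xs \<subseteq> X" "length xs = Suc n"
    by (auto simp: words_def)
  then obtain x ys where "xs = x # ys" by (cases xs) auto
  with xs show "y \<in> {x \<otimes>\<^bsub>M\<^esub> w | x w. x \<in> X \<and> w \<in> words M X n}"
    by (auto simp: words_def)
next
  fix y assume "y \<in> {x \<otimes>\<^bsub>M\<^esub> w | x w. x \<in> X \<and> w \<in> words M X n}"
  then obtain x xs where xs: "y = x \<otimes>\<^bsub>M\<^esub> foldr (mult M) xs \<one>\<^bsub>M\<^esub>" "x \<in> X" "set xs \<subseteq> X" "length xs = n"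
    by (auto simp: words_def)
  then show "y \<in> words M X (Suc n)"
    unfolding words_def by (intro CollectI exI[of _ "x # xs"]) auto
qed

lemma words_0: "words M X 0 = {\<one>\<^bsub>M\<^esub>}"
  by (auto simp: words_def)

section \<open>Products of spans and powers of subspaces\<close>

context assoc_algebra
begin

lemma subspace_power_words: "subspace_power K A U n = span (words A U n)"
  by (simp add: subspace_power_def words_def)

lemma linear_map_mult_left:
  assumes "a \<in> carrier A" shows "linear_map K A A (\<lambda>x. a \<otimes> x)"
proof -
  have "(\<lambda>x. a \<otimes> x) \<in> LinearCombinations.module_hom K A A"
    using assms by (simp add: LinearCombinations.module_hom_def r_distr smult_mult_right)
  then have "mod_hom K A A (\<lambda>x. a \<otimes> x)"
    by (intro mod_hom.intro mod_hom_axioms.intro module_axioms)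
  then show ?thesis
    by (simp add: linear_map_def vectorspace_axioms)
qed

lemma linear_map_mult_right:
  assumes "a \<in> carrier A" shows "linear_map K A A (\<lambda>x. x \<otimes> a)"
proof -
  have "(\<lambda>x. x \<otimes> a) \<in> LinearCombinations.module_hom K A A"
    using assms by (simp add: LinearCombinations.module_hom_def l_distr smult_mult_left)
  then have "mod_hom K A A (\<lambda>x. x \<otimes> a)"
    by (intro mod_hom.intro mod_hom_axioms.intro module_axioms)
  then show ?thesis
    by (simp add: linear_map_def vectorspace_axioms)
qed

end

text \<open>Used to extend a property from generators to their span: the vectors that a linear map
  sends into a given subspace form a subspace.\<close>

lemma (in linear_map) submodule_vimage:
  assumes "LinearCombinations.submodule K U W"
  shows "LinearCombinations.submodule K {v \<in> carrier V. T v \<in> U} V"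
proof -
  interpret U: LinearCombinations.submodule K U W by (rule assms)
  show ?thesis
    by unfold_locales auto
qed

context assoc_algebra
begin

text \<open>By bilinearity, in two stages: right multiplication by a fixed generator
  \<open>v\<close> is linear, which treats all \<open>x\<close> in \<open>span X\<close>; left
  multiplication by this \<open>x\<close> is linear, which treats all \<open>y\<close>.\<close>

lemma mult_mem_span:
  assumes X: "X \<subseteq> carrier A" and Y: "Y \<subseteq> carrier A" and x: "x \<in> span X" and y: "y \<in> span Y"
  shows "x \<otimes> y \<in> span {u \<otimes> v | u v. u \<in> X \<and> v \<in> Y}" (is "_ \<in> span ?P")
proof -
  have P: "?P \<subseteq> carrier A" using X Y by auto
  note sub = span_is_submodule[OF P]
  have xA: "x \<in> carrier A" using X x by auto
  have *: "x \<otimes> v \<in> span ?P" if v: "v \<in> Y" for v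
  proof -
    interpret R: linear_map K A A "\<lambda>z. z \<otimes> v"
      using linear_map_mult_right v Y by auto
    have "X \<subseteq> {z \<in> carrier A. z \<otimes> v \<in> span ?P}"
      using X v in_own_span[OF P] by blast
    from span_is_subset[OF this R.submodule_vimage[OF sub]] x show ?thesis by auto
  qed
  interpret L: linear_map K A A "\<lambda>z. x \<otimes> z"
    using linear_map_mult_left[OF xA] .
  have "Y \<subseteq> {z \<in> carrier A. x \<otimes> z \<in> span ?P}"
    using Y * by auto
  from span_is_subset[OF this L.submodule_vimage[OF sub]] y show ?thesis by auto
qed

text \<open>Reduces powers of a finite-dimensional subspace to words in a finite spanning set,
  whence these powers are finite-dimensional.\<close>

lemma span_words_span:
  assumes "X \<subseteq> carrier A"
  shows "span (words A (span X) n) = span (words A X n)"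
proof
  have W: "words A X m \<subseteq> carrier A" for m using words_closed assms by blast
  have "words A (span X) n \<subseteq> span (words A X n)"
  proof (induction n)
    case 0
    show ?case unfolding words_0 by (rule in_own_span) simp
  next
    case (Suc n)
    have "x \<otimes> w \<in> span (words A X (Suc n))" if "x \<in> span X" "w \<in> words A (span X) n" for x w
      using mult_mem_span[OF assms W that(1)] that(2) Suc unfolding words_Suc by blast
    then show ?case by (subst words_Suc) blast
  qed
  then show "span (words A (span X) n) \<subseteq> span (words A X n)"
    using span_is_subset span_is_submodule W by blast
  have "words A X n \<subseteq> words A (span X) n"
    using in_own_span[OF assms] unfolding words_def by blast
  then show "span (words A X n) \<subseteq> span (words A (span X) n)"
    by (rule span_is_monotone)
qed

lemma subspace_power_subspace:
  assumes "U \<subseteq> carrier A"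
  shows "VectorSpace.subspace K (subspace_power K A U n) A"
  unfolding subspace_power_words using assms by (intro span_is_subspace words_closed)

lemma fin_dim_subspace_power:
  assumes "VectorSpace.subspace K U A" "vectorspace.fin_dim K (A\<lparr>carrier := U\<rparr>)"
  shows "vectorspace.fin_dim K (A\<lparr>carrier := subspace_power K A U n\<rparr>)"
proof -
  obtain \<beta> where \<beta>: "finite \<beta>" "\<beta> \<subseteq> U" "span \<beta> = U"
    using subspace_basis_exists[OF assms] by metis
  have "U \<subseteq> carrier A"
    using is_module[OF assms(1)] by (simp add: LinearCombinations.submodule_def)
  with \<beta> have "\<beta> \<subseteq> carrier A" by blast
  then show ?thesis
    unfolding subspace_power_words \<beta>(3)[symmetric] span_words_span[OF \<open>\<beta> \<subseteq> carrier A\<close>]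
    using \<beta>(1) by (intro fin_dim_span finite_words words_closed)
qed

lemma subspace_power_mult:
  assumes "U \<subseteq> carrier A" "x \<in> U" "y \<in> subspace_power K A U n"
  shows "x \<otimes> y \<in> subspace_power K A U (Suc n)"
  using mult_mem_span[OF assms(1) words_closed[OF assms(1)], of x y n] assms in_own_span[OF assms(1)]
  unfolding subspace_power_words words_Suc by blast

lemma subspace_power_incseq:
  assumes "U \<subseteq> carrier A" "\<one> \<in> U"
  shows "subspace_power K A U n \<subseteq> subspace_power K A U (n + m)"
proof (induction m)
  case (Suc m)
  have "x \<in> subspace_power K A U (Suc (n + m))" if x: "x \<in> subspace_power K A U (n + m)" for x
  proof -
    have "x \<in> carrier A"
      using x words_closed[OF assms(1)] span_is_subset2 unfolding subspace_power_words by blast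
    then show ?thesis using subspace_power_mult[OF assms x] by simp
  qed
  with Suc show ?case by auto
qed auto

lemma one_mem_subspace_power:
  assumes "U \<subseteq> carrier A" "\<one> \<in> U"
  shows "\<one> \<in> subspace_power K A U n"
proof -
  have "\<one> \<in> subspace_power K A U 0"
    unfolding subspace_power_words words_0 using in_own_span[of "{\<one>}"] by simp
  then show ?thesis using subspace_power_incseq[OF assms, of 0 n] by auto
qed

lemma submodule_ring_center: "LinearCombinations.submodule K (ring_center A) A"
proof
  note sub = subringE[OF subring_ring_center]
  show "ring_center A \<subseteq> carrier A" using sub by blast
  show "\<zero> \<in> ring_center A" using sub by blast
  show "v \<oplus> w \<in> ring_center A" if "v \<in> ring_center A" "w \<in> ring_center A" for v w
    using sub that by blast
  fix c v assume cv: "c \<in> carrier K" "v \<in> ring_center A"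
  then have v: "v \<in> carrier A" using ring_center_closed by blast
  show "c \<odot> v \<in> ring_center A"
  proof (rule ring_centerI)
    fix x assume x: "x \<in> carrier A"
    show "c \<odot> v \<otimes> x = x \<otimes> (c \<odot> v)"
      using cv v x ring_center_commute[OF cv(2) x] by (simp add: smult_mult_left smult_mult_right)
  qed (use cv v in simp)
qed

lemma assoc_algebra_center_ring: "assoc_algebra K (center_ring A)"
proof -
  have "VectorSpace.subspace K (ring_center A) A"
    by (rule VectorSpace.subspace.intro[OF vectorspace_axioms submodule_ring_center])
  then have "vectorspace K (center_ring A)" by (rule subspace_is_vs)
  moreover have "ring (center_ring A)" by (rule ring_center_ring)
  moreover have "assoc_algebra_axioms K (center_ring A)"
    by (rule assoc_algebra_axioms.intro)
      (simp_all add: smult_mult_left smult_mult_right ring_center_closed)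
  ultimately show ?thesis by (rule assoc_algebra.intro)
qed

text \<open>Products and spans of central elements are the same in the center and in
  \<open>A\<close>, so the growth of the center can be measured inside \<open>A\<close>.\<close>

lemma subspace_power_center:
  assumes "W \<subseteq> ring_center A"
  shows "subspace_power K (center_ring A) W n = subspace_power K A W n"
    and "subspace_power K A W n \<subseteq> ring_center A"
proof -
  interpret Z: assoc_algebra K "center_ring A" by (rule assoc_algebra_center_ring)
  have eq: "words (center_ring A) W n = words A W n" by (simp add: words_def)
  have sub: "words A W n \<subseteq> ring_center A"
    using Z.words_closed[of W n] assms unfolding eq by simp
  show "subspace_power K (center_ring A) W n = subspace_power K A W n"
    unfolding subspace_power_words Z.subspace_power_words eq
    by (rule span_li_not_depend(1)[OF sub submodule_ring_center])
  show "subspace_power K A W n \<subseteq> ring_center A"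
    unfolding subspace_power_words
    by (rule span_is_subset[OF sub submodule_ring_center])
qed

lemma subspace_center_ringD:
  assumes "VectorSpace.subspace K W (center_ring A)"
  shows "W \<subseteq> ring_center A" "VectorSpace.subspace K W A"
proof -
  from assms have s: "LinearCombinations.submodule K W (center_ring A)"
    by (simp add: VectorSpace.subspace_def)
  interpret W: LinearCombinations.submodule K W "center_ring A" by (rule s)
  show W: "W \<subseteq> ring_center A" using W.subset by simp
  have "LinearCombinations.submodule K W A"
    using W ring_center_closed W.m_closed W.zero_closed W.smult_closed
    by (intro LinearCombinations.submodule.intro) (auto intro: module_axioms)
  then show "VectorSpace.subspace K W A"
    by (simp add: VectorSpace.subspace_def vectorspace_axioms)
qed

section \<open>Comparison of growth in the algebra with growth in its center\<close>

lemma lin_indpt_mult_left: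
  assumes a: "a \<in> carrier A" and inj: "inj_on (\<lambda>x. a \<otimes> x) (carrier A)"
    and T: "finite T" "T \<subseteq> carrier A" "lin_indpt T"
  shows "lin_indpt ((\<lambda>x. a \<otimes> x) ` T)"
proof (rule finite_lin_indpt2)
  interpret L: linear_map K A A "\<lambda>x. a \<otimes> x" using linear_map_mult_left[OF a] .
  fix c assume c: "c \<in> (\<lambda>x. a \<otimes> x) ` T \<rightarrow> carrier K" and 0: "lincomb c ((\<lambda>x. a \<otimes> x) ` T) = \<zero>"
  let ?t = "lincomb (c \<circ> (\<lambda>x. a \<otimes> x)) T"
  have c': "c \<circ> (\<lambda>x. a \<otimes> x) \<in> T \<rightarrow> carrier K" using c by auto
  then have t: "?t \<in> carrier A" using T by auto
  \<comment> \<open>A combination of the products \<open>a x\<close> is \<open>a\<close> times the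
    combination \<open>?t\<close> of the \<open>x\<close>, so injectivity forces
    \<open>?t = 0\<close>.\<close>
  have "a \<otimes> ?t = a \<otimes> \<zero>"
    using L.lincomb_linear_image[OF inj T(2) c T(1)] 0 r_null[OF a] by metis
  from inj_onD[OF inj this t] have t0: "?t = \<zero>" by simp
  show "\<forall>v\<in>(\<lambda>x. a \<otimes> x) ` T. c v = \<zero>\<^bsub>K\<^esub>"
    using lin_dep_crit[OF T(1) subset_refl c' _ _ t0] T(3) by auto
qed (use T a in auto)

text \<open>Each passage from \<open>T\<close> to \<beta> together with \<open>a T\<close> costs one
  factor from \<open>U\<close> and gains \<open>card \<beta>\<close> elements. Independence persists
  because the span of \<beta> is central and the span of \<open>a T\<close> lies in
  \<open>a A\<close>, which meets the center only in zero by \<open>meet\<close>.\<close>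

lemma lin_indpt_in_subspace_power:
  assumes a: "a \<in> carrier A" and inj: "inj_on (\<lambda>x. a \<otimes> x) (carrier A)"
    and meet: "\<And>b. \<lbrakk>b \<in> carrier A; a \<otimes> b \<in> ring_center A\<rbrakk> \<Longrightarrow> a \<otimes> b = \<zero>"
    and U: "U \<subseteq> carrier A" "\<one> \<in> U" "a \<in> U"
    and \<beta>: "finite \<beta>" "lin_indpt \<beta>" "\<beta> \<subseteq> ring_center A" "\<beta> \<subseteq> subspace_power K A U n"
  shows "\<exists>T. finite T \<and> T \<subseteq> subspace_power K A U (n + m) \<and> lin_indpt T \<and> card T = m * card \<beta>"
proof (induction m)
  case 0
  have "lin_indpt {}" by (rule finite_lin_indpt2) auto
  then show ?case by (intro exI[of _ "{}"]) simp
next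
  case (Suc m)
  then obtain T where T: "finite T" "T \<subseteq> subspace_power K A U (n + m)" "lin_indpt T"
    "card T = m * card \<beta>" by blast
  have TA: "T \<subseteq> carrier A"
    using T(2) span_is_subset2[OF words_closed[OF U(1)]] unfolding subspace_power_words by blast
  have \<beta>A: "\<beta> \<subseteq> carrier A" using \<beta>(3) ring_center_closed by blast
  let ?T = "(\<lambda>x. a \<otimes> x) ` T"
  interpret L: linear_map K A A "\<lambda>x. a \<otimes> x" using linear_map_mult_left[OF a] .
  have T'A: "?T \<subseteq> carrier A" using TA a by auto
  have "span ?T \<subseteq> L.im"
    using TA by (intro span_is_subset L.im_is_submodule) (auto simp: L.im_def)
  moreover have "span \<beta> \<subseteq> ring_center A"
    by (rule span_is_subset[OF \<beta>(3) submodule_ring_center])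
  ultimately have "span \<beta> \<inter> span ?T \<subseteq> {\<zero>}"
    using meet by (auto simp: L.im_def)
  note Un = lin_indpt_Un[OF \<beta>(1) finite_imageI[OF T(1)] \<beta>A T'A \<beta>(2)
      lin_indpt_mult_left[OF a inj T(1) TA T(3)] this]
  have "card (\<beta> \<union> ?T) = card \<beta> + card ?T"
    using Un(1) \<beta>(1) T(1) by (intro card_Un_disjoint) auto
  also have "card ?T = card T"
    using inj TA by (intro card_image) (rule inj_on_subset)
  finally have "card (\<beta> \<union> ?T) = Suc m * card \<beta>" using T(4) by simp
  moreover have "\<beta> \<subseteq> subspace_power K A U (n + Suc m)"
    using subspace_power_incseq[OF U(1,2)] \<beta>(4) by blast
  moreover have "?T \<subseteq> subspace_power K A U (n + Suc m)"
    using subspace_power_mult[OF U(1,3)] T(2) by auto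
  ultimately show ?case
    using Un(2) \<beta>(1) T(1) by (intro exI[of _ "\<beta> \<union> ?T"]) simp
qed

lemma dim_subspace_power_growth:
  assumes a: "a \<in> carrier A" and inj: "inj_on (\<lambda>x. a \<otimes> x) (carrier A)"
    and meet: "\<And>b. \<lbrakk>b \<in> carrier A; a \<otimes> b \<in> ring_center A\<rbrakk> \<Longrightarrow> a \<otimes> b = \<zero>"
    and W: "VectorSpace.subspace K W (center_ring A)"
      "vectorspace.fin_dim K (A\<lparr>carrier := W\<rparr>)" "\<one> \<in> W"
  obtains U where "VectorSpace.subspace K U A" "vectorspace.fin_dim K (A\<lparr>carrier := U\<rparr>)" "\<one> \<in> U"
    "\<And>n m. m * vectorspace.dim K (A\<lparr>carrier := subspace_power K A W n\<rparr>)
      \<le> vectorspace.dim K (A\<lparr>carrier := subspace_power K A U (n + m)\<rparr>)"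
proof -
  note WA = subspace_center_ringD[OF W(1)]
  have WA': "W \<subseteq> carrier A" using WA(1) ring_center_closed by blast
  obtain \<gamma> where \<gamma>: "finite \<gamma>" "\<gamma> \<subseteq> W" "span \<gamma> = W"
    using subspace_basis_exists[OF WA(2) W(2)] by metis
  \<comment> \<open>This is \<open>W + K a\<close>, written through a finite spanning set to keep it
    finite-dimensional.\<close>
  define U where "U = span (insert a \<gamma>)"
  have X: "insert a \<gamma> \<subseteq> carrier A" using a \<gamma>(2) WA' by blast
  have U: "VectorSpace.subspace K U A" "vectorspace.fin_dim K (A\<lparr>carrier := U\<rparr>)" "U \<subseteq> carrier A"
    unfolding U_def using X \<gamma>(1)
    by (auto intro!: span_is_subspace fin_dim_span span_is_subset2)
  have aU: "a \<in> U" using in_own_span[OF X] by (simp add: U_def)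
  have WU: "W \<subseteq> U" unfolding U_def \<gamma>(3)[symmetric] by (rule span_is_monotone) auto
  with W have 1: "\<one> \<in> U" by blast
  show ?thesis
  proof (rule that[OF U(1,2) 1])
    fix n m
    obtain \<beta> where \<beta>: "finite \<beta>" "\<beta> \<subseteq> subspace_power K A W n" "lin_indpt \<beta>"
      "card \<beta> = vectorspace.dim K (A\<lparr>carrier := subspace_power K A W n\<rparr>)"
      using subspace_basis_exists[OF subspace_power_subspace[OF WA']
          fin_dim_subspace_power[OF WA(2) W(2)]] by metis
    have "subspace_power K A W n \<subseteq> subspace_power K A U n"
      unfolding subspace_power_words
      by (rule span_is_monotone) (use WU in \<open>unfold words_def, blast\<close>)
    with \<beta>(2) subspace_power_center(2)[OF WA(1)]
    have "\<beta> \<subseteq> ring_center A" "\<beta> \<subseteq> subspace_power K A U n" by blast+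
    from lin_indpt_in_subspace_power[OF a inj meet U(3) 1 aU \<beta>(1,3) this]
    obtain T where "T \<subseteq> subspace_power K A U (n + m)" "lin_indpt T" "card T = m * card \<beta>"
      by blast
    with lin_indpt_subset_card_le(2)[OF subspace_power_subspace[OF U(3)]
        fin_dim_subspace_power[OF U(1,2)], of T "n + m"] \<beta>(4)
    show "m * vectorspace.dim K (A\<lparr>carrier := subspace_power K A W n\<rparr>)
      \<le> vectorspace.dim K (A\<lparr>carrier := subspace_power K A U (n + m)\<rparr>)"
      by simp
  qed
qed

text \<open>Keeps the arguments of the logarithms in the growth estimate positive: each power
  contains the nonzero unit.\<close>

lemma dim_subspace_power_pos:
  assumes "VectorSpace.subspace K U A" "vectorspace.fin_dim K (A\<lparr>carrier := U\<rparr>)" "\<one> \<in> U"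
    and "\<one> \<noteq> \<zero>"
  shows "vectorspace.dim K (A\<lparr>carrier := subspace_power K A U n\<rparr>) \<ge> 1"
proof -
  have U: "U \<subseteq> carrier A"
    using is_module[OF assms(1)] by (simp add: LinearCombinations.submodule_def)
  have li0: "lin_indpt {}" by (rule finite_lin_indpt2) auto
  have "lin_indpt {\<one>}"
    using lin_dep_iff_in_span[OF _ li0, of \<one>] assms(4) by (simp add: span_empty)
  then show ?thesis
    using lin_indpt_subset_card_le(2)[OF subspace_power_subspace[OF U]
        fin_dim_subspace_power[OF assms(1,2)], of "{\<one>}" n] one_mem_subspace_power[OF U assms(3)]
    by simp
qed

end

text \<open>Taking logarithms of \<open>n * d n \<le> e (2 n)\<close> and dividing by
  \<open>ln (2 n)\<close> bounds \<open>1 + ln (d n) / ln n\<close>, up to a factor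
  \<open>ln n / ln (2 n)\<close> that tends to one. Choosing equal exponents \<open>n\<close> and
  \<open>m\<close> in the growth estimate yields the hypothesis \<open>de\<close>.\<close>

lemma limsup_ln_quotient_add_1_le:
  fixes d e :: "nat \<Rightarrow> nat"
  assumes d: "\<And>n. d n \<ge> 1" and de: "\<And>n. n * d n \<le> e (n + n)"
  shows "limsup (\<lambda>n. ereal (ln (real (d n)) / ln (real n))) + 1
    \<le> limsup (\<lambda>n. ereal (ln (real (e n)) / ln (real n)))"
proof -
  let ?d = "\<lambda>n. ereal (ln (real (d n)) / ln (real n))"
  let ?e = "\<lambda>n. ereal (ln (real (e n)) / ln (real n))"
  let ?r = "\<lambda>n. ereal (ln (real n) / ln (real (n + n)))"
  have "(\<lambda>n. ln (real n) / ln (real (n + n))) \<longlonglongrightarrow> 1" by real_asymp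
  then have r: "?r \<longlonglongrightarrow> 1" unfolding one_ereal_def by (rule tendsto_ereal)
  \<comment> \<open>From \<open>n = 2\<close> on, \<open>ln n\<close> is positive and may be divided
    out.\<close>
  have le: "?r n * (1 + ?d n) \<le> ?e (n + n)" if n: "n \<ge> 2" for n
  proof -
    have "ln (real n) + ln (real (d n)) = ln (real (n * d n))"
      using n d[of n] by (simp add: ln_mult)
    also have "\<dots> \<le> ln (real (e (n + n)))"
      using n d[of n] de[of n] by (intro ln_mono) (auto simp flip: of_nat_mult)
    finally have *: "ln (real n) + ln (real (d n)) \<le> ln (real (e (n + n)))" .
    have "ln (real n) > 0" "ln (real (n + n)) > 0" using n by auto
    then have "ln (real n) / ln (real (n + n)) * (1 + ln (real (d n)) / ln (real n)) =
        (ln (real n) + ln (real (d n))) / ln (real (n + n))"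
      by (simp add: add_divide_distrib distrib_left)
    also have "\<dots> \<le> ln (real (e (n + n))) / ln (real (n + n))"
      using * \<open>ln (real (n + n)) > 0\<close> by (intro divide_right_mono) auto
    finally have "ln (real n) / ln (real (n + n)) * (1 + ln (real (d n)) / ln (real n))
        \<le> ln (real (e (n + n))) / ln (real (n + n))" .
    then show ?thesis by (simp add: one_ereal_def)
  qed
  have "limsup ?d + 1 = limsup (\<lambda>n. 1 + ?d n)"
    using ereal_limsup_lim_add[of "\<lambda>n. 1" 1 ?d] by (simp add: add.commute)
  \<comment> \<open>A factor converging to one does not change the upper limit.\<close>
  also have "\<dots> = limsup (\<lambda>n. ?r n * (1 + ?d n))"
    using ereal_limsup_lim_mult[OF r, of "\<lambda>n. 1 + ?d n"] by simp
  also have "\<dots> \<le> limsup (?e \<circ> (\<lambda>n. n + n))"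
    using le by (intro Limsup_mono eventually_sequentiallyI[of 2]) (simp add: o_def)
  \<comment> \<open>The estimate concerns only even indices, and the upper limit along a subsequence
    is at most that of the whole sequence.\<close>
  also have "\<dots> \<le> limsup ?e"
    by (rule limsup_subseq_mono) (simp add: strict_mono_def)
  finally show ?thesis .
qed

lemma (in assoc_algebra) GKdim_center_add_1_le:
  assumes "a \<in> carrier A" "inj_on (\<lambda>x. a \<otimes> x) (carrier A)" "\<one> \<noteq> \<zero>"
    and "\<And>b. \<lbrakk>b \<in> carrier A; a \<otimes> b \<in> ring_center A\<rbrakk> \<Longrightarrow> a \<otimes> b = \<zero>"
  shows "GKdim K (center_ring A) + 1 \<le> GKdim K A"
proof -
  \<comment> \<open>Moving the finite summand to the right allows the supremum over \<open>W\<close>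
    to be bounded member by member, also when a dimension is infinite.\<close>
  have "GKdim K (center_ring A) \<le> GKdim K A - 1"
    unfolding GKdim_def[of K "center_ring A"]
  proof (rule SUP_least, clarify)
    fix W assume W: "VectorSpace.subspace K W (center_ring A)"
      "vectorspace.fin_dim K (center_ring A\<lparr>carrier := W\<rparr>)" "\<one>\<^bsub>center_ring A\<^esub> \<in> W"
    then have W': "vectorspace.fin_dim K (A\<lparr>carrier := W\<rparr>)" "\<one> \<in> W" by simp_all
    note WA = subspace_center_ringD[OF W(1)]
    obtain U where U: "VectorSpace.subspace K U A" "vectorspace.fin_dim K (A\<lparr>carrier := U\<rparr>)" "\<one> \<in> U"
      and growth: "\<And>n m. m * vectorspace.dim K (A\<lparr>carrier := subspace_power K A W n\<rparr>)
        \<le> vectorspace.dim K (A\<lparr>carrier := subspace_power K A U (n + m)\<rparr>)"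
      using dim_subspace_power_growth[OF assms(1,2,4) W(1) W'] by metis
    let ?f = "\<lambda>V. limsup (\<lambda>n. ereal
      (ln (real (vectorspace.dim K (A\<lparr>carrier := subspace_power K A V n\<rparr>))) / ln (real n)))"
    have "?f W + 1 \<le> ?f U"
      using dim_subspace_power_pos[OF WA(2) W' assms(3)] growth
      by (rule limsup_ln_quotient_add_1_le)
    also have "?f U \<le> GKdim K A"
      unfolding GKdim_def by (rule SUP_upper) (use U in simp)
    finally show "limsup (\<lambda>n. ereal (ln (real (vectorspace.dim K (center_ring A
        \<lparr>carrier := subspace_power K (center_ring A) W n\<rparr>))) / ln (real n))) \<le> GKdim K A - 1"
      by (simp add: ereal_le_minus subspace_power_center(1)[OF WA(1)])
  qed
  then show ?thesis by (simp add: ereal_le_minus)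
qed

theorem theorem2p3:
  fixes K :: "('k, 'c) ring_scheme" and A :: "('k, 'a, 'm) module_scheme"
  assumes "field K"
    and "right_ore_domain A"
    and "assoc_algebra K A"
    and "finitely_generated_algebra K A"
    and "GKdim K A < GKdim K (center_ring A) + 1"
  shows "ring_center (right_fractions A) =
           {right_frac A p q | p q. p \<in> ring_center A \<and> q \<in> ring_center A \<and> q \<noteq> \<zero>\<^bsub>A\<^esub>}
       \<and> center_ring (right_fractions A) \<simeq> right_fractions (center_ring A)"
proof -
  interpret right_ore_domain A by (rule assms(2))
  interpret alg: assoc_algebra K A by (rule assms(3))
  have "\<exists>b\<in>carrier A. a \<otimes>\<^bsub>A\<^esub> b \<in> ring_center A \<and> a \<otimes>\<^bsub>A\<^esub> b \<noteq> \<zero>\<^bsub>A\<^esub>"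
    if a: "a \<in> carrier A" "a \<noteq> \<zero>\<^bsub>A\<^esub>" for a
  proof (rule ccontr)
    assume "\<not> ?thesis"
    \<comment> \<open>The negated claim says that every central multiple \<open>a b\<close> is zero;
      together with injectivity, from the absence of zero divisors, it makes the dimension estimate
      applicable.\<close>
    moreover have "inj_on (\<lambda>x. a \<otimes>\<^bsub>A\<^esub> x) (carrier A)"
      using a nc_mult_left_cancel by (intro inj_onI) blast
    ultimately have "GKdim K (center_ring A) + 1 \<le> GKdim K A"
      using a one_neq_zero by (intro alg.GKdim_center_add_1_le) auto
    with assms(5) show False by simp
  qed
  from ring_center_right_fractions[OF this] central_fractions_iso show ?thesis by blast
qed

end
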